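(* In the model $M(A,\mathscr F,\mathscr G)$, $\mathsf{HT}_2(2)$ fails, and hence so does $\mathsf{HT}_2(k)$ for every $k>2$.
   Context: Start from a model with a set of atoms $A$ of size continuum and a bijection $\omega^\omega\to A$, $f\mapsto a_f$. Equip $\omega^\omega$ with the metric $d(f,g)=0$ if $f=g$ and $d(f,g)=1/(1+\Delta(f,g))$ otherwise, where $\Delta(f,g)=\min\{k: f(k)\neq g(k)\}$; for $s\in\omega^{<\omega}$ let $U_s=\{f\in\omega^\omega: f\upharpoonright|s|=s\}$. Let $\mathscr G$ be the group of permutations $\pi_\varphi$ of $A$ given by $\pi_\varphi(a_f)=a_{\varphi(f)}$ for isometries $\varphi$ of $\omega^\omega$. For $n<\omega$ and finite $F\subseteq\omega^\omega$ let $G_{n,F}=\{\pi_\varphi: \varphi(f)=f\text{ for all }f\in F,\ \varphi[U_s]=U_s\text{ for all }s\in\omega^n\}$. Let $\mathscr F$ be the normal filter generated by the $G_{n,F}$, and $M(A,\mathscr F,\mathscr G)$ the resulting Fraenkel–Mostowski permutation model of $\mathsf{ZFA}$. $[X]^{<\omega}$ is the set of finite subsets of $X$ with symmetric difference $\triangle$; $\mathrm{FS}_{\leq 2}(Y)=\{F_1\triangle\cdots\triangle F_t: 1\le t\le 2,\ F_i\in Y\}$. $\mathsf{HT}_2(k)$: for every infinite set $X$ and every $c:[X]^{<\omega}\to k$ there is an infinite $Y\subseteq[X]^{<\omega}$ with $\mathrm{FS}_{\leq 2}(Y)$ $c$-monochromatic. *)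

theory Defs
  imports Complex_Main "HOL-Algebra.Coset"
begin

section \<open>The universe\<close>

text \<open>
  The type \<open>'v\<close> is the universe of sets and atoms; \<open>elts x\<close> collects the members of \<open>x\<close>.
  Separation and Replacement range over all HOL predicates and functions, so HOL's choice operator
  already yields the axiom of choice and it need not be assumed. For the same reason the
  \<open>\<omega>\<close> of the universe is the standard one and every subset of a set is a set: functions
  \<open>\<omega> \<rightarrow> \<omega>\<close>, permutations of the atoms and sets of such permutations can be represented
  by the corresponding HOL objects.
\<close>

locale zfa_universe =
  fixes elts :: "'v \<Rightarrow> 'v set" and atoms :: "'v set"
  assumes atoms_no_elts: "x \<in> atoms \<Longrightarrow> elts x = {}"
    and extensionality: "x \<notin> atoms \<Longrightarrow> y \<notin> atoms \<Longrightarrow> elts x = elts y \<Longrightarrow> x = y"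
    and foundation: "wf {(y, x). y \<in> elts x}"
    and set_of_atoms: "\<exists>z. z \<notin> atoms \<and> elts z = atoms"
    and pairing: "\<exists>z. z \<notin> atoms \<and> elts z = {x, y}"
    and union: "\<exists>z. z \<notin> atoms \<and> elts z = (\<Union>y \<in> elts x. elts y)"
    and power_set: "\<exists>z. z \<notin> atoms \<and> elts z = {y. y \<notin> atoms \<and> elts y \<subseteq> elts x}"
    and separation: "\<exists>z. z \<notin> atoms \<and> elts z = {y \<in> elts x. P y}"
    and replacement: "\<exists>z. z \<notin> atoms \<and> elts z = g ` elts x"
    and infinity: "\<exists>w. w \<notin> atoms \<and> (\<exists>e \<in> elts w. e \<notin> atoms \<and> elts e = {})
      \<and> (\<forall>x \<in> elts w. \<exists>y \<in> elts w. y \<notin> atoms \<and> elts y = insert x (elts x))"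


section \<open>Permutation models\<close>

text \<open>
  Permutations of the atoms are total functions on the universe that are the identity off the atoms.
\<close>

definition perm_group :: "('v \<Rightarrow> 'v) set \<Rightarrow> ('v \<Rightarrow> 'v) monoid" where
  "perm_group S = \<lparr>carrier = S, mult = (\<circ>), one = id\<rparr>"

definition normal_filter ::
  "'v set \<Rightarrow> ('v \<Rightarrow> 'v) monoid \<Rightarrow> ('v \<Rightarrow> 'v) set set \<Rightarrow> bool" where
  "normal_filter atoms G \<F> \<longleftrightarrow>
     (\<forall>H \<in> \<F>. subgroup H G) \<and>
     carrier G \<in> \<F> \<and>
     (\<forall>H K. H \<in> \<F> \<and> subgroup K G \<and> H \<subseteq> K \<longrightarrow> K \<in> \<F>) \<and>
     (\<forall>H \<in> \<F>. \<forall>K \<in> \<F>. H \<inter> K \<in> \<F>) \<and>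
     (\<forall>p \<in> carrier G. \<forall>H \<in> \<F>. (p <#\<^bsub>G\<^esub> H) #>\<^bsub>G\<^esub> (inv\<^bsub>G\<^esub> p) \<in> \<F>) \<and>
     (\<forall>x \<in> atoms. {p \<in> carrier G. p x = x} \<in> \<F>)"

definition generated_normal_filter ::
  "'v set \<Rightarrow> ('v \<Rightarrow> 'v) monoid \<Rightarrow> ('v \<Rightarrow> 'v) set set \<Rightarrow> ('v \<Rightarrow> 'v) set set" where
  "generated_normal_filter atoms G B = \<Inter> {\<F>. normal_filter atoms G \<F> \<and> B \<subseteq> \<F>}"

text \<open>The extension of a permutation \<open>p\<close> of the atoms to the universe, by \<open>\<in>\<close>-recursion.\<close>

definition act :: "('v \<Rightarrow> 'v set) \<Rightarrow> 'v set \<Rightarrow> ('v \<Rightarrow> 'v) \<Rightarrow> 'v \<Rightarrow> 'v" where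
  "act elts atoms p = wfrec {(y, x). y \<in> elts x}
     (\<lambda>h x. if x \<in> atoms then p x else (THE z. z \<notin> atoms \<and> elts z = h ` elts x))"

context zfa_universe
begin

lemma act_unfold:
  "act elts atoms p x = (if x \<in> atoms then p x
     else (THE z. z \<notin> atoms \<and> elts z = cut (act elts atoms p) {(y, x). y \<in> elts x} x ` elts x))"
  by (rule def_wfrec[OF act_def[THEN eq_reflection] foundation])

lemma act_atom: "x \<in> atoms \<Longrightarrow> act elts atoms p x = p x"
  by (subst act_unfold) (rule if_P)

lemma act_set:
  assumes "x \<notin> atoms"
  shows "act elts atoms p x \<notin> atoms \<and> elts (act elts atoms p x) = act elts atoms p ` elts x"
proof -
  let ?P = "\<lambda>z. z \<notin> atoms \<and> elts z = act elts atoms p ` elts x"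
  have "cut (act elts atoms p) {(y, x). y \<in> elts x} x ` elts x = act elts atoms p ` elts x"
    by (intro image_cong refl cut_apply) simp
  then have eq: "act elts atoms p x = (THE z. ?P z)"
    using act_unfold[of p x] assms by simp
  have "\<exists>!z. ?P z"
    using replacement[of "act elts atoms p" x] extensionality by metis
  then have "?P (THE z. ?P z)"
    by (rule theI')
  then show ?thesis
    unfolding eq[symmetric] .
qed

end

definition symmetric ::
  "('v \<Rightarrow> 'v set) \<Rightarrow> 'v set \<Rightarrow> ('v \<Rightarrow> 'v) set set \<Rightarrow> ('v \<Rightarrow> 'v) monoid \<Rightarrow> 'v \<Rightarrow> bool" where
  "symmetric elts atoms \<F> G x \<longleftrightarrow> {p \<in> carrier G. act elts atoms p x = x} \<in> \<F>"

definition perm_model ::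
  "('v \<Rightarrow> 'v set) \<Rightarrow> 'v set \<Rightarrow> ('v \<Rightarrow> 'v) set set \<Rightarrow> ('v \<Rightarrow> 'v) monoid \<Rightarrow> 'v set" where
  "perm_model elts atoms \<F> G =
     {x. \<forall>y. (\<lambda>u v. u \<in> elts v)\<^sup>*\<^sup>* y x \<longrightarrow> symmetric elts atoms \<F> G y}"


section \<open>The group of isometries of Baire space and its filter\<close>

definition Delta :: "(nat \<Rightarrow> nat) \<Rightarrow> (nat \<Rightarrow> nat) \<Rightarrow> nat" where
  "Delta f g = (LEAST k. f k \<noteq> g k)"

definition baire_dist :: "(nat \<Rightarrow> nat) \<Rightarrow> (nat \<Rightarrow> nat) \<Rightarrow> real" where
  "baire_dist f g = (if f = g then 0 else 1 / (1 + real (Delta f g)))"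

definition baire_isometry :: "((nat \<Rightarrow> nat) \<Rightarrow> (nat \<Rightarrow> nat)) \<Rightarrow> bool" where
  "baire_isometry \<phi> \<longleftrightarrow> bij \<phi> \<and> (\<forall>f g. baire_dist (\<phi> f) (\<phi> g) = baire_dist f g)"

definition cylinder :: "nat list \<Rightarrow> (nat \<Rightarrow> nat) set" where
  "cylinder s = {f. map f [0..<length s] = s}"

definition atom_perm ::
  "'v set \<Rightarrow> ((nat \<Rightarrow> nat) \<Rightarrow> 'v) \<Rightarrow> ((nat \<Rightarrow> nat) \<Rightarrow> (nat \<Rightarrow> nat)) \<Rightarrow> 'v \<Rightarrow> 'v" where
  "atom_perm atoms a \<phi> x = (if x \<in> atoms then a (\<phi> (inv_into UNIV a x)) else x)"

definition isom_group :: "'v set \<Rightarrow> ((nat \<Rightarrow> nat) \<Rightarrow> 'v) \<Rightarrow> ('v \<Rightarrow> 'v) monoid" where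
  "isom_group atoms a = perm_group {atom_perm atoms a \<phi> |\<phi>. baire_isometry \<phi>}"

definition basic_subgroup ::
  "'v set \<Rightarrow> ((nat \<Rightarrow> nat) \<Rightarrow> 'v) \<Rightarrow> nat \<Rightarrow> (nat \<Rightarrow> nat) set \<Rightarrow> ('v \<Rightarrow> 'v) set" where
  "basic_subgroup atoms a n F = {atom_perm atoms a \<phi> |\<phi>. baire_isometry \<phi> \<and>
     (\<forall>f \<in> F. \<phi> f = f) \<and> (\<forall>s. length s = n \<longrightarrow> \<phi> ` cylinder s = cylinder s)}"

definition isom_filter :: "'v set \<Rightarrow> ((nat \<Rightarrow> nat) \<Rightarrow> 'v) \<Rightarrow> ('v \<Rightarrow> 'v) set set" where
  "isom_filter atoms a = generated_normal_filter atoms (isom_group atoms a)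
     {basic_subgroup atoms a n F |n F. finite F}"


section \<open>The Hindman principle, evaluated in a class of sets and atoms\<close>

text \<open>
  The following are formulas of set theory with atoms with all quantifiers relativised to the
  class \<open>D\<close>; the free variables stand for members of \<open>D\<close>. Thus \<open>HT_2 D elts atoms k\<close> says that
  the structure \<open>D\<close> satisfies the principle for \<open>k\<close> colours.
\<close>

context
  fixes D :: "'v set" and elts :: "'v \<Rightarrow> 'v set" and atoms :: "'v set"
begin

definition is_empty :: "'v \<Rightarrow> bool" where
  "is_empty z \<longleftrightarrow> z \<notin> atoms \<and> (\<forall>w \<in> D. w \<notin> elts z)"

definition is_subset :: "'v \<Rightarrow> 'v \<Rightarrow> bool" where
  "is_subset z x \<longleftrightarrow> z \<notin> atoms \<and> x \<notin> atoms \<and> (\<forall>w \<in> D. w \<in> elts z \<longrightarrow> w \<in> elts x)"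

definition is_upair :: "'v \<Rightarrow> 'v \<Rightarrow> 'v \<Rightarrow> bool" where
  "is_upair z x y \<longleftrightarrow> z \<notin> atoms \<and> (\<forall>w \<in> D. w \<in> elts z \<longleftrightarrow> w = x \<or> w = y)"

definition is_opair :: "'v \<Rightarrow> 'v \<Rightarrow> 'v \<Rightarrow> bool" where
  "is_opair z x y \<longleftrightarrow> (\<exists>u \<in> D. \<exists>v \<in> D. is_upair u x x \<and> is_upair v x y \<and> is_upair z u v)"

definition is_symdiff :: "'v \<Rightarrow> 'v \<Rightarrow> 'v \<Rightarrow> bool" where
  "is_symdiff z x y \<longleftrightarrow> z \<notin> atoms \<and> (\<forall>w \<in> D. w \<in> elts z \<longleftrightarrow> ((w \<in> elts x) \<noteq> (w \<in> elts y)))"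

definition is_succ :: "'v \<Rightarrow> 'v \<Rightarrow> bool" where
  "is_succ z x \<longleftrightarrow> z \<notin> atoms \<and> (\<forall>w \<in> D. w \<in> elts z \<longleftrightarrow> w \<in> elts x \<or> w = x)"

primrec is_numeral :: "nat \<Rightarrow> 'v \<Rightarrow> bool" where
  "is_numeral 0 z \<longleftrightarrow> is_empty z"
| "is_numeral (Suc n) z \<longleftrightarrow> (\<exists>x \<in> D. is_numeral n x \<and> is_succ z x)"

definition is_inductive :: "'v \<Rightarrow> bool" where
  "is_inductive w \<longleftrightarrow> w \<notin> atoms \<and> (\<exists>z \<in> D. is_empty z \<and> z \<in> elts w) \<and>
     (\<forall>x \<in> D. x \<in> elts w \<longrightarrow> (\<exists>y \<in> D. is_succ y x \<and> y \<in> elts w))"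

definition in_omega :: "'v \<Rightarrow> bool" where
  "in_omega n \<longleftrightarrow> (\<forall>w \<in> D. is_inductive w \<longrightarrow> n \<in> elts w)"

definition is_value :: "'v \<Rightarrow> 'v \<Rightarrow> 'v \<Rightarrow> bool" where
  "is_value f x y \<longleftrightarrow> (\<exists>p \<in> D. is_opair p x y \<and> p \<in> elts f)"

definition is_function :: "'v \<Rightarrow> 'v \<Rightarrow> 'v \<Rightarrow> bool" where
  "is_function f X Y \<longleftrightarrow> f \<notin> atoms \<and>
     (\<forall>p \<in> D. p \<in> elts f \<longrightarrow> (\<exists>x \<in> D. \<exists>y \<in> D. x \<in> elts X \<and> y \<in> elts Y \<and> is_opair p x y)) \<and>
     (\<forall>x \<in> D. x \<in> elts X \<longrightarrow> (\<exists>!y. y \<in> D \<and> is_value f x y))"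

definition is_bijection :: "'v \<Rightarrow> 'v \<Rightarrow> 'v \<Rightarrow> bool" where
  "is_bijection f X Y \<longleftrightarrow> is_function f X Y \<and>
     (\<forall>y \<in> D. y \<in> elts Y \<longrightarrow> (\<exists>!x. x \<in> D \<and> is_value f x y))"

definition is_finite :: "'v \<Rightarrow> bool" where
  "is_finite X \<longleftrightarrow> X \<notin> atoms \<and> (\<exists>n \<in> D. in_omega n \<and> (\<exists>f \<in> D. is_bijection f n X))"

definition is_infinite :: "'v \<Rightarrow> bool" where
  "is_infinite X \<longleftrightarrow> X \<notin> atoms \<and> \<not> is_finite X"

definition is_finite_subsets :: "'v \<Rightarrow> 'v \<Rightarrow> bool" where
  "is_finite_subsets P X \<longleftrightarrow> P \<notin> atoms \<and>
     (\<forall>F \<in> D. F \<in> elts P \<longleftrightarrow> is_subset F X \<and> is_finite F)"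

text \<open>
  Membership in \<open>FS\<close> with at most two summands. The two summands are distinct, as usual for
  Hindman's theorem: otherwise the empty set would always belong to it, and the principle would be
  refuted outright by giving the empty set a colour of its own.
\<close>

definition in_FS2 :: "'v \<Rightarrow> 'v \<Rightarrow> bool" where
  "in_FS2 H Y \<longleftrightarrow> H \<in> elts Y \<or>
     (\<exists>F1 \<in> D. \<exists>F2 \<in> D. F1 \<in> elts Y \<and> F2 \<in> elts Y \<and> F1 \<noteq> F2 \<and> is_symdiff H F1 F2)"

definition HT_2 :: "nat \<Rightarrow> bool" where
  "HT_2 k \<longleftrightarrow>
     (\<forall>X \<in> D. \<forall>P \<in> D. \<forall>K \<in> D. \<forall>c \<in> D.
        is_infinite X \<and> is_finite_subsets P X \<and> is_numeral k K \<and> is_function c P K \<longrightarrow>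
        (\<exists>Y \<in> D. is_infinite Y \<and> is_subset Y P \<and>
           (\<exists>i \<in> D. i \<in> elts K \<and> (\<forall>H \<in> D. in_FS2 H Y \<longrightarrow> is_value c H i))))"

end

end

(* Colour the finite sets of atoms by giving a pair {a_f, a_g} the parity of Delta(f, g) and every
   other set the colour 0; isometries preserve this colouring, so it lies in the model. An infinite
   set Y of finite sets of atoms in the model is invariant under some G_{n,E}. Some H in Y contains
   a_f with f outside E. For every large j there is an isometry in G_{n,E} that sends f to
   g = f(j := f j + 1) and fixes the other points of H; the images of H lie in Y, and the symmetric
   difference of H with such an image is {a_f, a_g} with Delta(f, g) = j. Hence both parities occur. *)
theory Submission
  imports Defs "HOL-Combinatorics.Transposition"
begin

section \<open>Sets in the universe\<close>

text \<open>The principle is a formula relativised to the model. A counterexample must therefore be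
  an element of the model, and the clauses about functions, omega and finiteness must be read back
  as ordinary facts. This works because the model is transitive and every set with finitely many
  members, all in the model, is itself in the model: pairs, numerals and finiteness mean the same
  inside and outside. Only the infinite objects (the set of atoms, the set of its finite subsets,
  the colouring) need an invariance argument.

  The filter is given as an intersection of all normal filters above the G_{n,F}. It is used through
  an explicit description: the subgroups that contain some G_{n,F} with F finite.

  The level j has to be large for two reasons. It must be at least n, so that changing coordinate j
  preserves the cylinders of length n; and it must lie beyond the places where f separates from the
  points of E and from the other points of H, so that all of these stay fixed. As E and H are
  finite, one bound serves for all of them, and beyond it j is arbitrary.\<close>

context zfa_universe
begin

text \<open>Separates HOL sets that are extensions of sets of the universe from proper classes. The
  existence axioms become closure properties of \<open>small\<close>, and constructions can be done
  on HOL sets before \<open>mkset\<close> turns them into elements of the universe.\<close>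

definition small :: "'v set \<Rightarrow> bool" where
  "small S \<longleftrightarrow> (\<exists>z. z \<notin> atoms \<and> elts z = S)"

definition mkset :: "'v set \<Rightarrow> 'v" where
  "mkset S = (SOME z. z \<notin> atoms \<and> elts z = S)"

lemma mkset: "small S \<Longrightarrow> mkset S \<notin> atoms \<and> elts (mkset S) = S"
  unfolding small_def mkset_def by (rule someI_ex)

lemma mkset_eqI: "z \<notin> atoms \<Longrightarrow> elts z = S \<Longrightarrow> mkset S = z"
  by (metis extensionality mkset small_def)

lemma small_subset: "small S \<Longrightarrow> T \<subseteq> S \<Longrightarrow> small T"
  unfolding small_def using separation[of _ "\<lambda>y. y \<in> T"] by (metis Int_absorb1 Int_def)

lemma small_image: "small S \<Longrightarrow> small (g ` S)"
  unfolding small_def using replacement by metis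

lemma small_atoms: "small atoms"
  unfolding small_def by (rule set_of_atoms)

lemma small_pair: "small {x, y}"
  unfolding small_def by (rule pairing)

text \<open>The union axiom takes a single set of sets, so it is applied to the pair of
  \<open>mkset S\<close> and \<open>mkset T\<close>.\<close>

lemma small_Un:
  assumes "small S" "small T"
  shows "small (S \<union> T)"
proof -
  have "elts (mkset {mkset S, mkset T}) = {mkset S, mkset T}"
    using mkset small_pair by blast
  then show ?thesis
    using union[of "mkset {mkset S, mkset T}"] mkset[OF assms(1)] mkset[OF assms(2)]
    by (simp add: small_def)
qed

lemma small_finite: "finite S \<Longrightarrow> small S"
proof (induction rule: finite_induct)
  case empty
  show ?case by (rule small_subset[OF small_pair]) simp
next
  case (insert x S)
  then show ?case using small_Un[OF small_pair[of x x]] by simp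
qed

lemma small_Pow: "small S \<Longrightarrow> small {y. y \<notin> atoms \<and> elts y \<subseteq> S}"
  unfolding small_def using power_set by metis

lemma elts_not_atom: "x \<in> elts y \<Longrightarrow> y \<notin> atoms"
  using atoms_no_elts by blast

lemma elts_irrefl: "x \<notin> elts x"
  using foundation by (auto dest: wf_not_refl)

lemma act_mkset:
  assumes "small S"
  shows "act elts atoms p (mkset S) = mkset (act elts atoms p ` S)"
  using act_set[of "mkset S" p] mkset[OF assms] mkset_eqI by metis

lemma act_mem: "x \<in> elts y \<Longrightarrow> act elts atoms p x \<in> elts (act elts atoms p y)"
  using act_set[OF elts_not_atom] by blast

text \<open>Induction along membership. The hypothesis serves the atoms: \<open>act\<close>
  evaluates \<open>p\<close> at \<open>q x\<close> only if \<open>q x\<close> is again an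
  atom.\<close>

lemma act_comp:
  assumes "q ` atoms \<subseteq> atoms"
  shows "act elts atoms (p \<circ> q) x = act elts atoms p (act elts atoms q x)"
proof (induction x rule: wf_induct_rule[OF foundation])
  case (1 x)
  show ?case
  proof (cases "x \<in> atoms")
    case True
    then show ?thesis using assms by (auto simp: act_atom image_subset_iff)
  next
    case False
    then have "act elts atoms (p \<circ> q) ` elts x = act elts atoms p ` act elts atoms q ` elts x"
      unfolding image_image by (intro image_cong refl 1) simp
    then show ?thesis
      using act_set[OF False] act_set[of "act elts atoms q x" p]
      by (intro extensionality) metis+
  qed
qed

lemma act_id: "act elts atoms id x = x"
proof (induction x rule: wf_induct_rule[OF foundation])
  case (1 x)
  show ?case
  proof (cases "x \<in> atoms")
    case False
    then show ?thesis
      using 1 act_set[OF False, of id] by (intro extensionality) (auto simp del: id_apply)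
  qed (simp add: act_atom)
qed

section \<open>Von Neumann numerals and omega\<close>

primrec num :: "nat \<Rightarrow> 'v" where
  "num 0 = mkset {}"
| "num (Suc n) = mkset (insert (num n) (elts (num n)))"

lemma num: "num n \<notin> atoms \<and> elts (num n) = num ` {..<n}"
proof (induction n)
  case 0
  then show ?case using mkset[OF small_finite[of "{}"]] by simp
next
  case (Suc n)
  then have "small (insert (num n) (elts (num n)))"
    by (intro small_finite) auto
  with Suc show ?case using mkset by (simp add: lessThan_Suc)
qed

declare num.simps [simp del]

text \<open>For m < n the numeral of m is a member of the numeral of n, and foundation forbids
  self-membership.\<close>

lemma num_eq_iff [simp]: "num m = num n \<longleftrightarrow> m = n"
proof -
  have "num m \<noteq> num n" if "m < n" for m n
  proof -
    have "num m \<in> elts (num n)" using num[of n] that by auto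
    then show ?thesis using elts_irrefl by metis
  qed
  then show ?thesis by (metis linorder_neqE_nat)
qed

lemma act_num: "act elts atoms p (num n) = num n"
proof (induction n rule: less_induct)
  case (less n)
  then have "act elts atoms p ` num ` {..<n} = num ` {..<n}"
    by (simp add: image_image)
  then show ?case
    using act_set[of "num n" p] num[of n] by (intro extensionality) auto
qed

text \<open>The axiom of infinity only supplies some inductive set; it contains all numerals by
  induction, and separation cuts it down to them.\<close>

lemma small_range_num: "small (range num)"
proof -
  obtain w e where w: "e \<in> elts w" "e \<notin> atoms" "elts e = {}"
    "\<forall>x \<in> elts w. \<exists>y \<in> elts w. y \<notin> atoms \<and> elts y = insert x (elts x)" "w \<notin> atoms"
    using infinity by blast
  have "num n \<in> elts w" for n
  proof (induction n)
    case 0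
    then show ?case using w mkset_eqI num.simps(1) by metis
  next
    case (Suc n)
    then show ?case using w mkset_eqI by (metis num.simps(2))
  qed
  moreover have "small (elts w)"
    using w(5) by (auto simp: small_def)
  ultimately show ?thesis
    using small_subset[of "elts w"] by blast
qed

section \<open>Kuratowski pairs, the encoding behind \<open>is_opair\<close>\<close>

definition upair :: "'v \<Rightarrow> 'v \<Rightarrow> 'v" where
  "upair x y = mkset {x, y}"

definition opair :: "'v \<Rightarrow> 'v \<Rightarrow> 'v" where
  "opair x y = upair (upair x x) (upair x y)"

lemma upair: "upair x y \<notin> atoms \<and> elts (upair x y) = {x, y}"
  unfolding upair_def by (rule mkset[OF small_pair])

lemma upair_eq_iff: "upair x y = upair u v \<longleftrightarrow> {x, y} = {u, v}"
  using upair[of x y] upair[of u v] extensionality by metis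

lemma opair_eq_iff [simp]: "opair x y = opair u v \<longleftrightarrow> x = u \<and> y = v"
  unfolding opair_def upair_eq_iff by (auto simp: upair_eq_iff doubleton_eq_iff)

lemma act_opair: "act elts atoms p (opair x y) = opair (act elts atoms p x) (act elts atoms p y)"
  unfolding opair_def upair_def by (simp add: act_mkset small_pair small_finite)

end


section \<open>Absoluteness in permutation models\<close>

text \<open>Absoluteness does not depend on Baire space, so it is proved for an arbitrary group of
  permutations of the atoms with an arbitrary normal filter.\<close>

locale fm_model = zfa_universe elts atoms
  for elts :: "'v \<Rightarrow> 'v set" and atoms :: "'v set" +
  fixes S :: "('v \<Rightarrow> 'v) set" and \<F> :: "('v \<Rightarrow> 'v) set set"
  assumes group: "group (perm_group S)"
    and preserves_atoms: "p \<in> S \<Longrightarrow> p ` atoms \<subseteq> atoms"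
    and filter: "normal_filter atoms (perm_group S) \<F>"
begin

abbreviation D :: "'v set" where
  "D \<equiv> perm_model elts atoms \<F> (perm_group S)"

abbreviation sym :: "'v \<Rightarrow> bool" where
  "sym \<equiv> symmetric elts atoms \<F> (perm_group S)"

text \<open>Hereditary symmetry in recursive form, which replaces transitive closures in all later
  membership proofs. In the second direction a membership chain ending in \<open>x\<close> is split
  at its last step, whose lower end already lies in \<open>D\<close>.\<close>

lemma D_iff: "x \<in> D \<longleftrightarrow> sym x \<and> elts x \<subseteq> D"
proof (intro iffI conjI subsetI)
  assume x: "x \<in> D"
  then show "sym x" by (simp add: perm_model_def)
  fix y assume "y \<in> elts x"
  then have "(\<lambda>u v. u \<in> elts v)\<^sup>*\<^sup>* z x" if "(\<lambda>u v. u \<in> elts v)\<^sup>*\<^sup>* z y" for z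
    using that by (rule rtranclp.rtrancl_into_rtrancl[rotated])
  with x show "y \<in> D" by (simp add: perm_model_def)
next
  assume x: "sym x \<and> elts x \<subseteq> D"
  have "sym y" if "(\<lambda>u v. u \<in> elts v)\<^sup>*\<^sup>* y x" for y
    using that
  proof (cases rule: rtranclp.cases)
    case rtrancl_refl
    then show ?thesis using x by simp
  next
    case (rtrancl_into_rtrancl z)
    then have "z \<in> D" using x by blast
    with rtrancl_into_rtrancl show ?thesis by (simp add: perm_model_def)
  qed
  then show "x \<in> D" by (simp add: perm_model_def)
qed

lemma D_sym: "x \<in> D \<Longrightarrow> sym x"
  using D_iff by blast

lemma D_I: "sym x \<Longrightarrow> elts x \<subseteq> D \<Longrightarrow> x \<in> D"
  using D_iff by blast

lemma D_trans: "x \<in> elts y \<Longrightarrow> y \<in> D \<Longrightarrow> x \<in> D"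
  using D_iff by blast

text \<open>Undoing a permutation on the whole universe is what turns one-sided invariance
  statements into equalities and equivalences.\<close>

lemma inverse_perm:
  assumes "p \<in> S"
  obtains q where "q \<in> S" "\<forall>x. act elts atoms q (act elts atoms p x) = x"
    "\<forall>x. act elts atoms p (act elts atoms q x) = x"
proof -
  interpret G: group "perm_group S" by (rule group)
  have p: "p \<in> carrier (perm_group S)" using assms by (simp add: perm_group_def)
  let ?q = "inv\<^bsub>perm_group S\<^esub> p"
  have q: "?q \<in> S" using G.inv_closed[OF p] by (simp add: perm_group_def)
  have "?q \<circ> p = id" "p \<circ> ?q = id"
    using G.l_inv[OF p] G.r_inv[OF p] by (simp_all add: perm_group_def)
  then show thesis
    using that[OF q] act_comp preserves_atoms[OF q] preserves_atoms[OF assms] act_id by metis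
qed

lemma stabilizer_subgroup: "subgroup {p \<in> carrier (perm_group S). act elts atoms p x = x} (perm_group S)"
proof -
  interpret G: group "perm_group S" by (rule group)
  show ?thesis
  proof (rule G.subgroupI)
    have "id \<in> S" using G.one_closed by (simp add: perm_group_def)
    then show "{p \<in> carrier (perm_group S). act elts atoms p x = x} \<noteq> {}"
      using act_id by (auto simp: perm_group_def)
  next
    fix p assume p: "p \<in> {p \<in> carrier (perm_group S). act elts atoms p x = x}"
    let ?q = "inv\<^bsub>perm_group S\<^esub> p"
    have q: "?q \<in> carrier (perm_group S)" using p by simp
    moreover have "?q \<circ> p = id"
      using G.l_inv[of p] p by (simp add: perm_group_def)
    then have "act elts atoms ?q (act elts atoms p x) = x"
      using act_comp[of p ?q x] preserves_atoms[of p] p act_id by (simp add: perm_group_def)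
    ultimately show "?q \<in> {p \<in> carrier (perm_group S). act elts atoms p x = x}"
      using p by simp
  next
    fix p q
    assume pq: "p \<in> {p \<in> carrier (perm_group S). act elts atoms p x = x}"
      "q \<in> {p \<in> carrier (perm_group S). act elts atoms p x = x}"
    then have "p \<otimes>\<^bsub>perm_group S\<^esub> q \<in> carrier (perm_group S)" by auto
    moreover have "act elts atoms (p \<otimes>\<^bsub>perm_group S\<^esub> q) x = x"
      using pq act_comp[of q p x] preserves_atoms[of q] by (simp add: perm_group_def)
    ultimately show "p \<otimes>\<^bsub>perm_group S\<^esub> q \<in> {p \<in> carrier (perm_group S). act elts atoms p x = x}"
      by simp
  qed auto
qed

lemma filter_subset: "H \<in> \<F> \<Longrightarrow> H \<subseteq> S"
  using filter subgroup.subset unfolding normal_filter_def perm_group_def by fastforce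

lemma filter_carrier: "S \<in> \<F>"
  using filter unfolding normal_filter_def perm_group_def by auto

lemma filter_Int: "H \<in> \<F> \<Longrightarrow> K \<in> \<F> \<Longrightarrow> H \<inter> K \<in> \<F>"
  using filter unfolding normal_filter_def by blast

lemma filter_atom: "x \<in> atoms \<Longrightarrow> {p \<in> carrier (perm_group S). p x = x} \<in> \<F>"
  using filter unfolding normal_filter_def by blast

text \<open>The filter is upward closed only among subgroups, which is why the stabilizer of
  \<open>x\<close> had to be shown to be one; it contains \<open>H\<close> and so belongs to the
  filter.\<close>

lemma symI:
  assumes "H \<in> \<F>" "\<And>p. p \<in> H \<Longrightarrow> act elts atoms p x = x"
  shows "sym x"
proof -
  have "H \<subseteq> {p \<in> carrier (perm_group S). act elts atoms p x = x}"
    using assms filter_subset[OF assms(1)] by (auto simp: perm_group_def)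
  then show ?thesis
    using filter assms(1) stabilizer_subgroup unfolding symmetric_def normal_filter_def by blast
qed

lemma sym_invariant:
  assumes "\<And>p. p \<in> S \<Longrightarrow> act elts atoms p x = x"
  shows "sym x"
  using symI[OF filter_carrier] assms by blast

text \<open>Applying closure also to the inverse of \<open>p\<close> shows that \<open>p\<close>
  maps \<open>T\<close> onto itself, so the whole group fixes \<open>mkset T\<close>. The infinite
  parameters of the counterexample enter the model this way.\<close>

lemma invariant_set_in_D:
  assumes "small T" "T \<subseteq> D" and inv: "\<And>p x. p \<in> S \<Longrightarrow> x \<in> T \<Longrightarrow> act elts atoms p x \<in> T"
  shows "mkset T \<in> D"
proof -
  have "act elts atoms p ` T = T" if p: "p \<in> S" for p
  proof
    obtain q where "q \<in> S" "\<And>x. act elts atoms p (act elts atoms q x) = x"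
      using inverse_perm[OF p] by metis
    then show "T \<subseteq> act elts atoms p ` T" using inv by (metis image_iff subsetI)
    show "act elts atoms p ` T \<subseteq> T" using inv p by blast
  qed
  then have "sym (mkset T)"
    using assms(1) by (intro sym_invariant) (simp add: act_mkset)
  then show ?thesis using mkset[OF assms(1)] assms(2) by (intro D_I) auto
qed

lemma atom_in_D:
  assumes "x \<in> atoms"
  shows "x \<in> D"
proof -
  have "sym x" by (rule symI[OF filter_atom[OF assms]]) (simp add: act_atom assms)
  then show ?thesis using atoms_no_elts[OF assms] by (intro D_I) auto
qed

lemma common_stabilizer:
  assumes "finite X" "X \<subseteq> D"
  shows "\<exists>H \<in> \<F>. \<forall>p \<in> H. \<forall>x \<in> X. act elts atoms p x = x"
  using assms
proof (induction rule: finite_induct)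
  case empty
  then show ?case using filter_carrier by blast
next
  case (insert x X)
  then obtain H where H: "H \<in> \<F>" "\<forall>p \<in> H. \<forall>x \<in> X. act elts atoms p x = x" by auto
  let ?K = "{p \<in> carrier (perm_group S). act elts atoms p x = x}"
  have "?K \<in> \<F>" using insert.prems D_sym[of x] by (simp add: symmetric_def)
  then have "H \<inter> ?K \<in> \<F>" using H(1) filter_Int by blast
  then show ?case using H(2) by (intro bexI[of _ "H \<inter> ?K"]) auto
qed

text \<open>Finitely many stabilizers intersect in a member of the filter. It fixes every element of
  \<open>z\<close>, hence \<open>z\<close>.\<close>

lemma finite_in_D:
  assumes "finite (elts z)" "elts z \<subseteq> D" "z \<notin> atoms"
  shows "z \<in> D"
proof -
  obtain H where H: "H \<in> \<F>" "\<forall>p \<in> H. \<forall>x \<in> elts z. act elts atoms p x = x"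
    using common_stabilizer[OF assms(1,2)] by blast
  have "sym z"
  proof (rule symI[OF H(1)])
    fix p assume "p \<in> H"
    then show "act elts atoms p z = z"
      using H(2) act_set[OF assms(3), of p] assms(3) by (intro extensionality) auto
  qed
  then show ?thesis using assms(2) by (rule D_I)
qed

lemma mkset_in_D: "finite X \<Longrightarrow> X \<subseteq> D \<Longrightarrow> mkset X \<in> D"
  using finite_in_D[of "mkset X"] mkset[OF small_finite] by simp

lemma upair_in_D: "x \<in> D \<Longrightarrow> y \<in> D \<Longrightarrow> upair x y \<in> D"
  unfolding upair_def by (rule mkset_in_D) auto

lemma opair_in_D: "x \<in> D \<Longrightarrow> y \<in> D \<Longrightarrow> opair x y \<in> D"
  unfolding opair_def by (intro upair_in_D)

lemma num_in_D: "num n \<in> D"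
proof (induction n rule: less_induct)
  case (less n)
  then show ?case using num[of n] by (intro finite_in_D) auto
qed

section \<open>Absoluteness of pairs, omega, functions and finiteness\<close>

lemma is_upair_iff:
  assumes "z \<in> D" "x \<in> D" "y \<in> D"
  shows "is_upair D elts atoms z x y \<longleftrightarrow> z = upair x y"
proof -
  have "is_upair D elts atoms z x y \<longleftrightarrow> z \<notin> atoms \<and> elts z = {x, y}"
    using assms D_trans by (auto simp: is_upair_def)
  then show ?thesis
    using upair[of x y] extensionality[of z "upair x y"] by auto
qed

lemma is_opair_iff:
  assumes "z \<in> D" "x \<in> D" "y \<in> D"
  shows "is_opair D elts atoms z x y \<longleftrightarrow> z = opair x y"
  using assms by (auto simp: is_opair_def opair_def is_upair_iff upair_in_D)

lemma is_succ_iff: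
  assumes "z \<in> D" "x \<in> D"
  shows "is_succ D elts atoms z x \<longleftrightarrow> z \<notin> atoms \<and> elts z = insert x (elts x)"
  using assms D_trans unfolding is_succ_def by auto

lemma is_succ_num:
  assumes "z \<in> D"
  shows "is_succ D elts atoms z (num n) \<longleftrightarrow> z = num (Suc n)"
proof -
  have "elts (num (Suc n)) = insert (num n) (elts (num n))"
    using num[of n] num[of "Suc n"] by (simp add: lessThan_Suc)
  then show ?thesis
    using is_succ_iff[OF assms num_in_D] extensionality[of z "num (Suc n)"] num[of "Suc n"] by metis
qed

lemma is_empty_iff:
  assumes "z \<in> D"
  shows "is_empty D elts atoms z \<longleftrightarrow> z = num 0"
proof -
  have "is_empty D elts atoms z \<longleftrightarrow> z \<notin> atoms \<and> elts z = {}"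
    using assms D_trans by (auto simp: is_empty_def)
  then show ?thesis
    using num[of 0] extensionality[of z "num 0"] by auto
qed

lemma is_numeral_num: "is_numeral D elts atoms n (num n)"
proof (induction n)
  case 0
  then show ?case using is_empty_iff num_in_D by simp
next
  case (Suc n)
  then show ?case using is_succ_num num_in_D by auto
qed

text \<open>The true omega is fixed by every permutation, so it lies in \<open>D\<close> and is one
  of the inductive sets over which \<open>in_omega\<close> quantifies. Conversely, induction puts
  every numeral into each inductive set of \<open>D\<close>.\<close>

lemma in_omega_iff: "in_omega D elts atoms x \<longleftrightarrow> x \<in> range num"
proof
  let ?\<omega> = "mkset (range num)"
  have \<omega>: "?\<omega> \<notin> atoms" "elts ?\<omega> = range num"
    using mkset[OF small_range_num] by auto
  have "sym ?\<omega>"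
    by (rule sym_invariant) (simp add: act_mkset small_range_num image_image act_num)
  then have "?\<omega> \<in> D" using \<omega> num_in_D by (intro D_I) auto
  moreover have "is_inductive D elts atoms ?\<omega>"
    unfolding is_inductive_def \<omega>(2)
    using \<omega>(1) num_in_D is_empty_iff is_succ_num by blast
  moreover assume "in_omega D elts atoms x"
  ultimately show "x \<in> range num" using \<omega>(2) by (auto simp: in_omega_def)
next
  assume "x \<in> range num"
  then obtain n where x: "x = num n" by blast
  show "in_omega D elts atoms x"
    unfolding in_omega_def
  proof (intro ballI impI)
    fix w assume w: "w \<in> D" "is_inductive D elts atoms w"
    have "num n \<in> elts w"
    proof (induction n)
      case 0
      then show ?case using w is_empty_iff by (auto simp: is_inductive_def)
    next
      case (Suc n)
      then show ?case using w is_succ_num num_in_D by (auto simp: is_inductive_def)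
    qed
    then show "x \<in> elts w" using x by simp
  qed
qed

lemma is_value_iff:
  assumes "f \<in> D" "x \<in> D" "y \<in> D"
  shows "is_value D elts atoms f x y \<longleftrightarrow> opair x y \<in> elts f"
  using assms is_opair_iff opair_in_D by (auto simp: is_value_def)

lemma is_value_graph:
  assumes "f \<in> D" "x \<in> D" "y \<in> D" "elts f = (\<lambda>x. opair x (g x)) ` elts X"
  shows "is_value D elts atoms f x y \<longleftrightarrow> x \<in> elts X \<and> y = g x"
  using assms by (auto simp: is_value_iff)

lemma is_function_graph:
  assumes f: "f \<in> D" "f \<notin> atoms" "elts f = (\<lambda>x. opair x (g x)) ` elts X"
    and XY: "X \<in> D" "Y \<in> D" "g ` elts X \<subseteq> elts Y"
  shows "is_function D elts atoms f X Y"
  unfolding is_function_def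
proof (intro conjI ballI impI)
  have D: "x \<in> D" "g x \<in> D" if "x \<in> elts X" for x
    using that XY D_trans by blast+
  show "f \<notin> atoms" by (rule f)
  show "\<exists>x \<in> D. \<exists>y \<in> D. x \<in> elts X \<and> y \<in> elts Y \<and> is_opair D elts atoms p x y"
    if p: "p \<in> D" "p \<in> elts f" for p
  proof -
    obtain x where "x \<in> elts X" "p = opair x (g x)" using p f(3) by auto
    then show ?thesis using D[of x] XY(3) is_opair_iff[of p x "g x"] p(1) by blast
  qed
  show "\<exists>!y. y \<in> D \<and> is_value D elts atoms f x y" if "x \<in> D" "x \<in> elts X" for x
    using that D[of x] is_value_graph[OF f(1) _ _ f(3)] by blast
qed

text \<open>A bijection in the model exhibits the set as an image of a numeral. Conversely, the
  graph of an external enumeration is a finite set of pairs from \<open>D\<close>, so the model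
  contains it.\<close>

lemma is_finite_iff:
  assumes "X \<in> D" "X \<notin> atoms"
  shows "is_finite D elts atoms X \<longleftrightarrow> finite (elts X)"
proof
  assume "is_finite D elts atoms X"
  then obtain n f where f: "f \<in> D" "is_bijection D elts atoms f (num n) X"
    unfolding is_finite_def using in_omega_iff by auto
  \<comment> \<open>The description operator reads the internal function as a HOL function, so that
    \<open>elts X\<close> becomes contained in the image of a finite set.\<close>
  have "\<exists>x \<in> elts (num n). y = (THE y. y \<in> D \<and> is_value D elts atoms f x y)" if y: "y \<in> elts X" for y
  proof -
    have "y \<in> D" using y assms D_trans by blast
    then obtain x where x: "x \<in> D" "is_value D elts atoms f x y"
      using f y unfolding is_bijection_def by metis
    have "x \<in> elts (num n)"
    proof -
      have "opair x y \<in> elts f" using x f \<open>y \<in> D\<close> is_value_iff by blast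
      moreover have "opair x y \<in> D" using x \<open>y \<in> D\<close> opair_in_D by blast
      ultimately obtain u v where "u \<in> D" "v \<in> D" "u \<in> elts (num n)"
        "is_opair D elts atoms (opair x y) u v"
        using f(2) unfolding is_bijection_def is_function_def by blast
      with \<open>opair x y \<in> D\<close> show ?thesis using is_opair_iff by auto
    qed
    moreover have "\<exists>!y. y \<in> D \<and> is_value D elts atoms f x y"
      using f(2) x \<open>x \<in> elts (num n)\<close> unfolding is_bijection_def is_function_def by blast
    ultimately show ?thesis
      using x(2) \<open>y \<in> D\<close> by (intro bexI[of _ x] the1_equality[symmetric]) auto
  qed
  then have "elts X \<subseteq> (\<lambda>x. THE y. y \<in> D \<and> is_value D elts atoms f x y) ` elts (num n)"
    by blast
  then show "finite (elts X)"
    by (rule finite_subset) (simp add: num)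
next
  assume fin: "finite (elts X)"
  define n where "n = card (elts X)"
  obtain h where h: "bij_betw h {..<n} (elts X)"
    using ex_bij_betw_nat_finite[OF fin] unfolding n_def by (auto simp: lessThan_atLeast0)
  have hX: "h i \<in> elts X" if "i < n" for i
    using bij_betw_apply[OF h] that by simp
  have hD: "h i \<in> D" if "i < n" for i
    using hX[OF that] assms D_trans by blast
  \<comment> \<open>The graph lemmas expect a function on the universe, so the enumeration is
    transported along the inverse of \<open>num\<close>; only its values at numerals below
    \<open>n\<close> matter.\<close>
  define g where "g x = h (inv_into UNIV num x)" for x
  have g: "g (num i) = h i" for i
    by (simp add: g_def inv_f_f inj_def)
  define f where "f = mkset ((\<lambda>x. opair x (g x)) ` elts (num n))"
  have f: "f \<notin> atoms" "elts f = (\<lambda>x. opair x (g x)) ` elts (num n)"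
    using mkset[OF small_finite, of "(\<lambda>x. opair x (g x)) ` elts (num n)"] num[of n]
    unfolding f_def by auto
  have fD: "f \<in> D"
    unfolding f_def using num[of n] by (intro mkset_in_D) (auto simp: g opair_in_D num_in_D hD)
  have "is_function D elts atoms f (num n) X"
    using f fD assms num_in_D hX num[of n] by (intro is_function_graph[where g = g]) (auto simp: g)
  moreover have "\<exists>!x. x \<in> D \<and> is_value D elts atoms f x y" if y: "y \<in> elts X" for y
  proof -
    obtain i where i: "i < n" "y = h i"
      using h y by (auto simp: bij_betw_def)
    have yD: "y \<in> D" using y assms D_trans by blast
    have "is_value D elts atoms f x y \<longleftrightarrow> x = num i" if "x \<in> D" for x
    proof -
      have "is_value D elts atoms f x y \<longleftrightarrow> (\<exists>j<n. x = num j \<and> y = h j)"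
        using is_value_graph[OF fD that yD f(2)] num[of n] g by auto
      also have "\<dots> \<longleftrightarrow> x = num i"
        using i bij_betw_imp_inj_on[OF h] unfolding inj_on_def by blast
      finally show ?thesis .
    qed
    then show ?thesis using num_in_D[of i] by blast
  qed
  ultimately have "is_bijection D elts atoms f (num n) X"
    by (auto simp: is_bijection_def)
  then show "is_finite D elts atoms X"
    unfolding is_finite_def using assms fD num_in_D in_omega_iff by blast
qed

end


section \<open>Isometries of Baire space\<close>

text \<open>Equivalent to distance at most 1/(1+n), or to lying in the same cylinder of length n. It
  eliminates real numbers and, unlike \<open>Delta\<close>, is meaningful for equal
  arguments.\<close>

definition agree :: "nat \<Rightarrow> (nat \<Rightarrow> nat) \<Rightarrow> (nat \<Rightarrow> nat) \<Rightarrow> bool" where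
  "agree n f g \<longleftrightarrow> (\<forall>k<n. f k = g k)"

lemma agree_refl [simp]: "agree n f f"
  by (simp add: agree_def)

lemma agree_sym: "agree n f g \<Longrightarrow> agree n g f"
  by (simp add: agree_def)

lemma agree_trans: "agree n f g \<Longrightarrow> agree n g h \<Longrightarrow> agree n f h"
  by (simp add: agree_def)

lemma agree_mono: "agree n f g \<Longrightarrow> m \<le> n \<Longrightarrow> agree m f g"
  by (simp add: agree_def)

text \<open>Equality is excluded because \<open>Delta f f\<close> is a \<open>LEAST\<close> over an
  empty condition.\<close>

lemma agree_iff_Delta:
  assumes "f \<noteq> g"
  shows "agree n f g \<longleftrightarrow> n \<le> Delta f g"
proof
  obtain k where k: "f k \<noteq> g k" using assms by blast
  then have D: "f (Delta f g) \<noteq> g (Delta f g)"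
    unfolding Delta_def by (rule LeastI)
  show "n \<le> Delta f g" if "agree n f g"
    using that D by (metis agree_def not_le)
  show "agree n f g" if "n \<le> Delta f g"
    unfolding agree_def
  proof (intro allI impI)
    fix k assume "k < n"
    then have "k < (LEAST k. f k \<noteq> g k)" using that by (simp add: Delta_def)
    then show "f k = g k" by (blast dest: not_less_Least)
  qed
qed

lemma Delta_commute: "Delta f g = Delta g f"
  unfolding Delta_def by (simp add: eq_commute)

lemma Delta_fun_upd: "x \<noteq> f j \<Longrightarrow> Delta f (f(j := x)) = j"
  unfolding Delta_def by (rule Least_equality) (auto split: if_splits)

text \<open>Each member of \<open>B\<close> departs from \<open>f\<close> at some coordinate, and
  disagreement persists for longer initial segments; finiteness of \<open>B\<close> allows taking a
  maximum.\<close>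

lemma eventually_disagree:
  assumes "finite B" "f \<notin> B"
  shows "\<exists>m\<ge>n. \<forall>h \<in> B. \<not> agree m h f"
  using assms
proof (induction rule: finite_induct)
  case empty
  then show ?case by blast
next
  case (insert h B)
  then obtain m where m: "m \<ge> n" "\<forall>h \<in> B. \<not> agree m h f" by auto
  have "h \<noteq> f" using insert.prems by auto
  then have "\<not> agree (Suc (Delta h f)) h f" by (simp add: agree_iff_Delta)
  with m(2) have "\<forall>g \<in> insert h B. \<not> agree (max m (Suc (Delta h f))) g f"
    using agree_mono max.cobounded1 max.cobounded2 by blast
  then show ?case using m(1) max.coboundedI1 by blast
qed

text \<open>The distance of distinct points determines \<open>Delta\<close>, which in turn is
  determined by the initial segments on which they agree. Bijectivity keeps distinct points
  distinct.\<close>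

lemma baire_isometry_iff:
  "baire_isometry \<phi> \<longleftrightarrow> bij \<phi> \<and> (\<forall>n f g. agree n (\<phi> f) (\<phi> g) \<longleftrightarrow> agree n f g)"
proof -
  have "baire_dist (\<phi> f) (\<phi> g) = baire_dist f g \<longleftrightarrow> (\<forall>n. agree n (\<phi> f) (\<phi> g) \<longleftrightarrow> agree n f g)"
    if "bij \<phi>" for f g
  proof (cases "f = g")
    case False
    then have \<phi>: "\<phi> f \<noteq> \<phi> g"
      using that by (auto simp: bij_def inj_def)
    have "baire_dist (\<phi> f) (\<phi> g) = baire_dist f g \<longleftrightarrow> Delta (\<phi> f) (\<phi> g) = Delta f g"
      using False \<phi> by (simp add: baire_dist_def)
    also have "\<dots> \<longleftrightarrow> (\<forall>n. n \<le> Delta (\<phi> f) (\<phi> g) \<longleftrightarrow> n \<le> Delta f g)"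
      by (auto intro: order_antisym)
    finally show ?thesis
      using False \<phi> by (simp add: agree_iff_Delta)
  qed (simp add: baire_dist_def)
  then show ?thesis unfolding baire_isometry_def by blast
qed

lemma baire_isometry_id: "baire_isometry id"
  by (simp add: baire_isometry_def)

lemma baire_isometry_comp: "baire_isometry \<phi> \<Longrightarrow> baire_isometry \<psi> \<Longrightarrow> baire_isometry (\<phi> \<circ> \<psi>)"
  by (auto simp: baire_isometry_def intro: bij_comp)

lemma baire_isometry_inv:
  assumes "baire_isometry \<phi>"
  shows "baire_isometry (inv_into UNIV \<phi>)"
proof -
  have "baire_dist (inv_into UNIV \<phi> f) (inv_into UNIV \<phi> g) = baire_dist f g" for f g
    using assms unfolding baire_isometry_def by (metis bij_inv_eq_iff)
  then show ?thesis
    using assms by (simp add: baire_isometry_def bij_imp_bij_inv)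
qed

text \<open>Preservation of agreement, applied to the images of two points, gives its own
  converse.\<close>

lemma baire_isometry_involution:
  assumes "\<And>h. \<phi> (\<phi> h) = h" "\<And>n g h. agree n g h \<Longrightarrow> agree n (\<phi> g) (\<phi> h)"
  shows "baire_isometry \<phi>"
proof -
  have "agree n (\<phi> g) (\<phi> h) \<longleftrightarrow> agree n g h" for n g h
    using assms(2)[of n g h] assms(2)[of n "\<phi> g" "\<phi> h"] assms(1) by auto
  moreover have "bij \<phi>" using assms(1) by (rule involuntory_imp_bij)
  ultimately show ?thesis by (simp add: baire_isometry_iff)
qed

lemma mem_cylinder: "f \<in> cylinder s \<longleftrightarrow> (\<forall>k<length s. f k = s ! k)"
  using list_eq_iff_nth_eq[of "map f [0..<length s]" s] by (simp add: cylinder_def)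

text \<open>The cylinders of length n are the classes of \<open>agree n\<close>. Pointwise agreement
  yields equality of preimages first; surjectivity turns this into equality of images.\<close>

lemma preserves_cylinders_iff:
  assumes "bij \<phi>"
  shows "(\<forall>s. length s = n \<longrightarrow> \<phi> ` cylinder s = cylinder s) \<longleftrightarrow> (\<forall>f. agree n (\<phi> f) f)"
proof (intro iffI allI impI)
  fix f assume *: "\<forall>s. length s = n \<longrightarrow> \<phi> ` cylinder s = cylinder s"
  have "f \<in> cylinder (map f [0..<n])" by (simp add: mem_cylinder)
  then have "\<phi> f \<in> cylinder (map f [0..<n])" using * by (metis imageI length_map length_upt diff_zero)
  then show "agree n (\<phi> f) f" by (simp add: mem_cylinder agree_def)
next
  fix s :: "nat list" assume *: "\<forall>f. agree n (\<phi> f) f" and "length s = n"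
  then have "\<phi> f \<in> cylinder s \<longleftrightarrow> f \<in> cylinder s" for f
    by (simp add: mem_cylinder agree_def)
  then have "\<phi> -` cylinder s = cylinder s" by auto
  then show "\<phi> ` cylinder s = cylinder s"
    using assms by (metis bij_is_surj surj_image_vimage_eq)
qed

text \<open>The automorphism of the tree of finite sequences that interchanges two neighbouring
  subtrees above the restriction of \<open>f\<close> to \<open>j\<close>: the one through
  \<open>f\<close> and the one whose next value is \<open>Suc (f j)\<close>. Tails are copied
  unchanged.\<close>

definition branch_swap :: "(nat \<Rightarrow> nat) \<Rightarrow> nat \<Rightarrow> (nat \<Rightarrow> nat) \<Rightarrow> (nat \<Rightarrow> nat)" where
  "branch_swap f j h = (if agree j h f then h(j := transpose (f j) (Suc (f j)) (h j)) else h)"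

lemma branch_swap_agree: "agree j (branch_swap f j h) h"
  by (simp add: branch_swap_def agree_def)

text \<open>Nothing changes below \<open>j\<close>, which settles agreement up to n \<le> j. Points
  that agree beyond \<open>j\<close> are either both moved, by the same transposition of the same
  value, or both fixed.\<close>

lemma branch_swap_isometry: "baire_isometry (branch_swap f j)"
proof (rule baire_isometry_involution)
  show "branch_swap f j (branch_swap f j h) = h" for h
  proof (cases "agree j h f")
    case True
    then have "agree j (branch_swap f j h) f"
      using branch_swap_agree agree_trans by blast
    then show ?thesis using True by (simp add: branch_swap_def)
  qed (simp add: branch_swap_def)
  show "agree n (branch_swap f j g) (branch_swap f j h)" if gh: "agree n g h" for n g h
  proof (cases "n \<le> j")
    case True
    then show ?thesis
      using gh branch_swap_agree agree_mono agree_trans agree_sym by meson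
  next
    case False
    then have "g j = h j" "agree j g h"
      using gh by (auto simp: agree_def)
    then have "agree j g f \<longleftrightarrow> agree j h f"
      using agree_trans agree_sym by blast
    then show ?thesis
      using gh \<open>g j = h j\<close> by (auto simp: branch_swap_def agree_def)
  qed
qed


section \<open>The filter of isometries\<close>

locale isom_model = zfa_universe elts atoms
  for elts :: "'v \<Rightarrow> 'v set" and atoms :: "'v set" +
  fixes a :: "(nat \<Rightarrow> nat) \<Rightarrow> 'v"
  assumes bij_a: "bij_betw a UNIV atoms"
begin

abbreviation S :: "('v \<Rightarrow> 'v) set" where
  "S \<equiv> {atom_perm atoms a \<phi> |\<phi>. baire_isometry \<phi>}"

lemma a_atom [simp]: "a f \<in> atoms"
  using bij_a by (auto simp: bij_betw_def)

lemma a_eq_iff [simp]: "a f = a g \<longleftrightarrow> f = g"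
  using bij_a by (auto simp: bij_betw_def inj_def)

lemma atomE: "x \<in> atoms \<Longrightarrow> (\<And>f. x = a f \<Longrightarrow> thesis) \<Longrightarrow> thesis"
  using bij_a by (auto simp: bij_betw_def)

lemma atom_perm_a [simp]: "atom_perm atoms a \<phi> (a f) = a (\<phi> f)"
  by (simp add: atom_perm_def inv_f_f inj_def)

lemma atom_perm_comp: "atom_perm atoms a \<phi> \<circ> atom_perm atoms a \<psi> = atom_perm atoms a (\<phi> \<circ> \<psi>)"
proof
  fix x show "(atom_perm atoms a \<phi> \<circ> atom_perm atoms a \<psi>) x = atom_perm atoms a (\<phi> \<circ> \<psi>) x"
    by (cases "x \<in> atoms") (auto elim!: atomE simp: atom_perm_def[of _ _ _ x])
qed

lemma atom_perm_id: "atom_perm atoms a id = id"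
proof
  fix x show "atom_perm atoms a id x = id x"
  proof (cases "x \<in> atoms")
    case True
    then obtain f where "x = a f" by (rule atomE)
    then show ?thesis by simp
  qed (simp add: atom_perm_def)
qed

lemma carrier_isom_group: "carrier (isom_group atoms a) = S"
  by (simp add: isom_group_def perm_group_def)

lemma mult_isom_group: "p \<otimes>\<^bsub>isom_group atoms a\<^esub> q = p \<circ> q"
  by (simp add: isom_group_def perm_group_def)

lemma group_isom: "group (isom_group atoms a)"
proof (rule groupI)
  have one: "\<one>\<^bsub>isom_group atoms a\<^esub> = id"
    by (simp add: isom_group_def perm_group_def)
  show "\<one>\<^bsub>isom_group atoms a\<^esub> \<in> carrier (isom_group atoms a)"
    unfolding one carrier_isom_group using atom_perm_id baire_isometry_id by force
  show "\<one>\<^bsub>isom_group atoms a\<^esub> \<otimes>\<^bsub>isom_group atoms a\<^esub> p = p" for p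
    unfolding one mult_isom_group by simp
  show "p \<otimes>\<^bsub>isom_group atoms a\<^esub> q \<in> carrier (isom_group atoms a)"
    if "p \<in> carrier (isom_group atoms a)" "q \<in> carrier (isom_group atoms a)" for p q
    using that unfolding carrier_isom_group mult_isom_group
    using atom_perm_comp baire_isometry_comp by auto
  show "p \<otimes>\<^bsub>isom_group atoms a\<^esub> q \<otimes>\<^bsub>isom_group atoms a\<^esub> r
      = p \<otimes>\<^bsub>isom_group atoms a\<^esub> (q \<otimes>\<^bsub>isom_group atoms a\<^esub> r)" for p q r
    unfolding mult_isom_group by (rule comp_assoc)
  show "\<exists>q \<in> carrier (isom_group atoms a). q \<otimes>\<^bsub>isom_group atoms a\<^esub> p = \<one>\<^bsub>isom_group atoms a\<^esub>"
    if p: "p \<in> carrier (isom_group atoms a)" for p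
  proof -
    obtain \<phi> where \<phi>: "p = atom_perm atoms a \<phi>" "baire_isometry \<phi>"
      using p carrier_isom_group by auto
    then have "atom_perm atoms a (inv_into UNIV \<phi>) \<circ> p = id"
      by (simp add: atom_perm_comp atom_perm_id baire_isometry_def bij_def)
    moreover have "atom_perm atoms a (inv_into UNIV \<phi>) \<in> S"
      using baire_isometry_inv[OF \<phi>(2)] by blast
    ultimately show ?thesis
      unfolding one mult_isom_group carrier_isom_group by blast
  qed
qed

sublocale G: group "isom_group atoms a"
  by (rule group_isom)

lemma inv_atom_perm:
  assumes "baire_isometry \<phi>"
  shows "inv\<^bsub>isom_group atoms a\<^esub> (atom_perm atoms a \<phi>) = atom_perm atoms a (inv_into UNIV \<phi>)"
proof (rule G.inv_equality)
  show "atom_perm atoms a (inv_into UNIV \<phi>) \<otimes>\<^bsub>isom_group atoms a\<^esub> atom_perm atoms a \<phi> = \<one>\<^bsub>isom_group atoms a\<^esub>"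
    using assms unfolding mult_isom_group
    by (simp add: atom_perm_comp atom_perm_id baire_isometry_def bij_def isom_group_def perm_group_def)
qed (use assms baire_isometry_inv in \<open>auto simp: carrier_isom_group\<close>)

lemma basic_subgroup_eq:
  "basic_subgroup atoms a n F = {atom_perm atoms a \<phi> |\<phi>. baire_isometry \<phi> \<and>
     (\<forall>f \<in> F. \<phi> f = f) \<and> (\<forall>f. agree n (\<phi> f) f)}"
proof -
  have "baire_isometry \<phi> \<and> P \<and> (\<forall>s. length s = n \<longrightarrow> \<phi> ` cylinder s = cylinder s)
      \<longleftrightarrow> baire_isometry \<phi> \<and> P \<and> (\<forall>f. agree n (\<phi> f) f)" for \<phi> P
    using preserves_cylinders_iff[of \<phi> n] by (auto simp: baire_isometry_def)
  then show ?thesis unfolding basic_subgroup_def by simp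
qed

lemma basic_subgroupI:
  "baire_isometry \<phi> \<Longrightarrow> (\<And>f. f \<in> F \<Longrightarrow> \<phi> f = f) \<Longrightarrow> (\<And>f. agree n (\<phi> f) f)
    \<Longrightarrow> atom_perm atoms a \<phi> \<in> basic_subgroup atoms a n F"
  unfolding basic_subgroup_eq by blast

lemma basic_subgroupE:
  assumes "p \<in> basic_subgroup atoms a n F"
  obtains \<phi> where "p = atom_perm atoms a \<phi>" "baire_isometry \<phi>" "\<forall>f \<in> F. \<phi> f = f"
    "\<forall>f. agree n (\<phi> f) f"
  using assms unfolding basic_subgroup_eq by blast

lemma basic_subgroup: "subgroup (basic_subgroup atoms a n F) (isom_group atoms a)"
proof (rule G.subgroupI)
  show "basic_subgroup atoms a n F \<subseteq> carrier (isom_group atoms a)"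
    unfolding carrier_isom_group basic_subgroup_def by blast
  have "atom_perm atoms a id \<in> basic_subgroup atoms a n F"
    by (rule basic_subgroupI) (simp_all add: baire_isometry_id)
  then show "basic_subgroup atoms a n F \<noteq> {}" by blast
next
  fix p assume "p \<in> basic_subgroup atoms a n F"
  then obtain \<phi> where \<phi>: "p = atom_perm atoms a \<phi>" "baire_isometry \<phi>" "\<forall>f \<in> F. \<phi> f = f"
    "\<forall>f. agree n (\<phi> f) f" by (rule basic_subgroupE)
  have "bij \<phi>" using \<phi>(2) by (simp add: baire_isometry_def)
  have "atom_perm atoms a (inv_into UNIV \<phi>) \<in> basic_subgroup atoms a n F"
  proof (rule basic_subgroupI)
    show "baire_isometry (inv_into UNIV \<phi>)" by (rule baire_isometry_inv[OF \<phi>(2)])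
    show "inv_into UNIV \<phi> f = f" if "f \<in> F" for f
      using \<phi>(3) that \<open>bij \<phi>\<close> by (metis bij_inv_eq_iff)
    show "agree n (inv_into UNIV \<phi> f) f" for f
      using \<phi>(4)[rule_format, of "inv_into UNIV \<phi> f"] \<open>bij \<phi>\<close> agree_sym by (metis bij_inv_eq_iff)
  qed
  then show "inv\<^bsub>isom_group atoms a\<^esub> p \<in> basic_subgroup atoms a n F"
    using \<phi> inv_atom_perm by simp
next
  fix p q assume p: "p \<in> basic_subgroup atoms a n F" and q: "q \<in> basic_subgroup atoms a n F"
  from p obtain \<phi> where \<phi>: "p = atom_perm atoms a \<phi>" "baire_isometry \<phi>" "\<forall>f \<in> F. \<phi> f = f"
    "\<forall>f. agree n (\<phi> f) f" by (rule basic_subgroupE)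
  from q obtain \<psi> where \<psi>: "q = atom_perm atoms a \<psi>" "baire_isometry \<psi>" "\<forall>f \<in> F. \<psi> f = f"
    "\<forall>f. agree n (\<psi> f) f" by (rule basic_subgroupE)
  have "atom_perm atoms a (\<phi> \<circ> \<psi>) \<in> basic_subgroup atoms a n F"
    using \<phi> \<psi> agree_trans by (intro basic_subgroupI baire_isometry_comp) (auto, blast)
  then show "p \<otimes>\<^bsub>isom_group atoms a\<^esub> q \<in> basic_subgroup atoms a n F"
    using \<phi> \<psi> by (simp add: mult_isom_group atom_perm_comp)
qed

text \<open>The explicit form of the generated normal filter, with the groups G_{n,F} as a
  base.\<close>

definition supported_subgroups :: "('v \<Rightarrow> 'v) set set" where
  "supported_subgroups = {K. subgroup K (isom_group atoms a) \<and>
     (\<exists>n F. finite F \<and> basic_subgroup atoms a n F \<subseteq> K)}"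

text \<open>Conjugation by \<psi> only moves the support: the conjugate of G_{n,F} contains
  G_{n,F'}, where F' is the image of F under \<psi>. The preimage of a given \<chi> is \<psi>^{-1}
  \<chi> \<psi>.\<close>

lemma supported_conjugate:
  assumes p: "p \<in> carrier (isom_group atoms a)" and H: "H \<in> supported_subgroups"
  shows "(p <#\<^bsub>isom_group atoms a\<^esub> H) #>\<^bsub>isom_group atoms a\<^esub> (inv\<^bsub>isom_group atoms a\<^esub> p) \<in> supported_subgroups"
    (is "?C \<in> _")
proof -
  let ?G = "isom_group atoms a"
  interpret H: subgroup H ?G using H by (simp add: supported_subgroups_def)
  have C: "?C = (\<lambda>h. p \<otimes>\<^bsub>?G\<^esub> h \<otimes>\<^bsub>?G\<^esub> inv\<^bsub>?G\<^esub> p) ` H"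
    by (auto simp: l_coset_def r_coset_def)
  have "subgroup ?C ?G"
  proof (rule G.subgroupI)
    show "?C \<subseteq> carrier ?G" unfolding C using p by auto
    show "?C \<noteq> {}" unfolding C using H.one_closed by blast
  next
    fix x assume "x \<in> ?C"
    then obtain h where h: "h \<in> H" "x = p \<otimes>\<^bsub>?G\<^esub> h \<otimes>\<^bsub>?G\<^esub> inv\<^bsub>?G\<^esub> p" unfolding C by blast
    then have "inv\<^bsub>?G\<^esub> x = p \<otimes>\<^bsub>?G\<^esub> inv\<^bsub>?G\<^esub> h \<otimes>\<^bsub>?G\<^esub> inv\<^bsub>?G\<^esub> p"
      using p by (simp add: G.inv_mult_group G.m_assoc)
    then show "inv\<^bsub>?G\<^esub> x \<in> ?C" unfolding C using h H.m_inv_closed by blast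
  next
    fix x y assume "x \<in> ?C" "y \<in> ?C"
    then obtain h k where hk: "h \<in> H" "x = p \<otimes>\<^bsub>?G\<^esub> h \<otimes>\<^bsub>?G\<^esub> inv\<^bsub>?G\<^esub> p"
      "k \<in> H" "y = p \<otimes>\<^bsub>?G\<^esub> k \<otimes>\<^bsub>?G\<^esub> inv\<^bsub>?G\<^esub> p" unfolding C by blast
    have "inv\<^bsub>?G\<^esub> p \<otimes>\<^bsub>?G\<^esub> (p \<otimes>\<^bsub>?G\<^esub> z) = z" if "z \<in> carrier ?G" for z
      using p that by (simp add: G.m_assoc[symmetric])
    then have "x \<otimes>\<^bsub>?G\<^esub> y = p \<otimes>\<^bsub>?G\<^esub> (h \<otimes>\<^bsub>?G\<^esub> k) \<otimes>\<^bsub>?G\<^esub> inv\<^bsub>?G\<^esub> p"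
      using p hk by (simp add: G.m_assoc)
    then show "x \<otimes>\<^bsub>?G\<^esub> y \<in> ?C" unfolding C using hk H.m_closed by blast
  qed
  moreover obtain n F where F: "finite F" "basic_subgroup atoms a n F \<subseteq> H"
    using H by (auto simp: supported_subgroups_def)
  obtain \<psi> where \<psi>: "p = atom_perm atoms a \<psi>" "baire_isometry \<psi>"
    using p carrier_isom_group by auto
  have bij: "bij \<psi>" using \<psi>(2) by (simp add: baire_isometry_def)
  have "basic_subgroup atoms a n (\<psi> ` F) \<subseteq> ?C"
  proof
    fix q assume "q \<in> basic_subgroup atoms a n (\<psi> ` F)"
    then obtain \<chi> where \<chi>: "q = atom_perm atoms a \<chi>" "baire_isometry \<chi>"
      "\<forall>f \<in> \<psi> ` F. \<chi> f = f" "\<forall>f. agree n (\<chi> f) f" by (rule basic_subgroupE)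
    let ?h = "atom_perm atoms a (inv_into UNIV \<psi> \<circ> \<chi> \<circ> \<psi>)"
    have "?h \<in> basic_subgroup atoms a n F"
    proof (rule basic_subgroupI)
      show "baire_isometry (inv_into UNIV \<psi> \<circ> \<chi> \<circ> \<psi>)"
        using \<psi> \<chi> by (intro baire_isometry_comp baire_isometry_inv)
      show "(inv_into UNIV \<psi> \<circ> \<chi> \<circ> \<psi>) f = f" if "f \<in> F" for f
        using \<chi>(3) that bij by (simp add: bij_is_inj)
      show "agree n ((inv_into UNIV \<psi> \<circ> \<chi> \<circ> \<psi>) f) f" for f
      proof -
        \<comment> \<open>The number \<open>n\<close> survives conjugation because the inverse of
          \<psi> is an isometry: it carries the agreement of \<chi>(\<psi> f) with \<psi> f back to
          level \<open>n\<close>.\<close>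
        have "agree n (inv_into UNIV \<psi> (\<chi> (\<psi> f))) (inv_into UNIV \<psi> (\<psi> f))"
          using baire_isometry_inv[OF \<psi>(2)] \<chi>(4) by (simp add: baire_isometry_iff)
        then show ?thesis using bij by (simp add: bij_is_inj)
      qed
    qed
    then have "?h \<in> H" using F by blast
    moreover have "q = p \<otimes>\<^bsub>?G\<^esub> ?h \<otimes>\<^bsub>?G\<^esub> inv\<^bsub>?G\<^esub> p"
    proof -
      have "\<psi> \<circ> (inv_into UNIV \<psi> \<circ> \<chi> \<circ> \<psi>) \<circ> inv_into UNIV \<psi> = \<chi>"
        using bij by (simp add: fun_eq_iff bij_is_surj surj_f_inv_f)
      then show ?thesis
        unfolding mult_isom_group \<psi>(1) inv_atom_perm[OF \<psi>(2)] atom_perm_comp \<chi>(1) by simp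
    qed
    ultimately show "q \<in> ?C" unfolding C by blast
  qed
  ultimately show ?thesis
    unfolding supported_subgroups_def using F(1) finite_imageI by blast
qed

lemma normal_filter_supported: "normal_filter atoms (isom_group atoms a) supported_subgroups"
  unfolding normal_filter_def
proof (intro conjI ballI allI impI)
  let ?G = "isom_group atoms a"
  show "subgroup H ?G" if "H \<in> supported_subgroups" for H
    using that by (simp add: supported_subgroups_def)
  have "basic_subgroup atoms a 0 {} \<subseteq> carrier ?G"
    using basic_subgroup by (rule subgroup.subset)
  then show "carrier ?G \<in> supported_subgroups"
    unfolding supported_subgroups_def using G.subgroup_self by blast
  show "K \<in> supported_subgroups" if "H \<in> supported_subgroups \<and> subgroup K ?G \<and> H \<subseteq> K" for H K
    using that unfolding supported_subgroups_def by blast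
  show "H \<inter> K \<in> supported_subgroups" if H: "H \<in> supported_subgroups" and K: "K \<in> supported_subgroups" for H K
  proof -
    obtain n F m E where F: "finite F" "basic_subgroup atoms a n F \<subseteq> H"
      "finite E" "basic_subgroup atoms a m E \<subseteq> K"
      using H K unfolding supported_subgroups_def by blast
    have "basic_subgroup atoms a (max n m) (F \<union> E) \<subseteq> basic_subgroup atoms a n F \<inter> basic_subgroup atoms a m E"
    proof
      fix p assume "p \<in> basic_subgroup atoms a (max n m) (F \<union> E)"
      then obtain \<phi> where \<phi>: "p = atom_perm atoms a \<phi>" "baire_isometry \<phi>" "\<forall>f \<in> F \<union> E. \<phi> f = f"
        "\<forall>f. agree (max n m) (\<phi> f) f" by (rule basic_subgroupE)
      then have "agree n (\<phi> f) f" "agree m (\<phi> f) f" for f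
        using agree_mono[of "max n m"] by auto
      with \<phi> show "p \<in> basic_subgroup atoms a n F \<inter> basic_subgroup atoms a m E"
        by (auto intro!: basic_subgroupI)
    qed
    then have "basic_subgroup atoms a (max n m) (F \<union> E) \<subseteq> H \<inter> K" using F by blast
    moreover have "subgroup (H \<inter> K) ?G"
      using H K by (simp add: supported_subgroups_def G.subgroups_Inter_pair)
    ultimately show ?thesis
      unfolding supported_subgroups_def using F finite_UnI by blast
  qed
  show "(p <#\<^bsub>?G\<^esub> H) #>\<^bsub>?G\<^esub> (inv\<^bsub>?G\<^esub> p) \<in> supported_subgroups"
    if "p \<in> carrier ?G" "H \<in> supported_subgroups" for p H
    using that by (rule supported_conjugate)
  show "{p \<in> carrier ?G. p x = x} \<in> supported_subgroups" if "x \<in> atoms" for x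
  proof -
    obtain f where f: "x = a f" using \<open>x \<in> atoms\<close> by (rule atomE)
    have "subgroup {p \<in> carrier ?G. p x = x} ?G"
    proof (rule G.subgroupI)
      have "\<one>\<^bsub>?G\<^esub> x = x" by (simp add: isom_group_def perm_group_def)
      then show "{p \<in> carrier ?G. p x = x} \<noteq> {}" using G.one_closed by blast
      show "inv\<^bsub>?G\<^esub> p \<in> {p \<in> carrier ?G. p x = x}" if p: "p \<in> {p \<in> carrier ?G. p x = x}" for p
      proof -
        have "inv\<^bsub>?G\<^esub> p \<circ> p = id"
          using p G.l_inv[of p] by (simp add: isom_group_def perm_group_def)
        then have "(inv\<^bsub>?G\<^esub> p) (p x) = x" by (metis comp_apply id_apply)
        then show ?thesis using p by simp
      qed
      show "p \<otimes>\<^bsub>?G\<^esub> q \<in> {p \<in> carrier ?G. p x = x}"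
        if "p \<in> {p \<in> carrier ?G. p x = x}" "q \<in> {p \<in> carrier ?G. p x = x}" for p q
        using that G.m_closed[of p q] by (simp add: mult_isom_group)
    qed auto
    moreover have "basic_subgroup atoms a 0 {f} \<subseteq> {p \<in> carrier ?G. p x = x}"
      unfolding carrier_isom_group basic_subgroup_eq using f by auto
    ultimately show ?thesis
      unfolding supported_subgroups_def by blast
  qed
qed

text \<open>The explicit family is a normal filter containing the generators, so it bounds the
  intersection from above; upward closure forces every competing normal filter to contain
  it.\<close>

lemma isom_filter_eq: "isom_filter atoms a = supported_subgroups"
proof
  have "{basic_subgroup atoms a n F |n F. finite F} \<subseteq> supported_subgroups"
  proof
    fix K assume "K \<in> {basic_subgroup atoms a n F |n F. finite F}"
    then obtain n F where "finite F" "K = basic_subgroup atoms a n F" by blast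
    then show "K \<in> supported_subgroups"
      unfolding supported_subgroups_def using basic_subgroup by auto
  qed
  with normal_filter_supported show "isom_filter atoms a \<subseteq> supported_subgroups"
    unfolding isom_filter_def generated_normal_filter_def by (intro Inter_lower) simp
  show "supported_subgroups \<subseteq> isom_filter atoms a"
  proof
    fix K assume "K \<in> supported_subgroups"
    then obtain n F where K: "subgroup K (isom_group atoms a)" "finite F" "basic_subgroup atoms a n F \<subseteq> K"
      unfolding supported_subgroups_def by blast
    show "K \<in> isom_filter atoms a"
      unfolding isom_filter_def generated_normal_filter_def
    proof (intro InterI, elim CollectE conjE)
      fix \<F> assume \<F>: "normal_filter atoms (isom_group atoms a) \<F>"
        "{basic_subgroup atoms a n F |n F. finite F} \<subseteq> \<F>"
      then have "basic_subgroup atoms a n F \<in> \<F>" using K(2) by blast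
      then show "K \<in> \<F>" using \<F>(1) K(1,3) unfolding normal_filter_def by blast
    qed
  qed
qed

sublocale fm_model elts atoms S "isom_filter atoms a"
proof (intro fm_model.intro fm_model_axioms.intro)
  show "zfa_universe elts atoms" by (rule zfa_universe_axioms)
  show "group (perm_group S)" using group_isom by (simp add: isom_group_def)
  show "normal_filter atoms (perm_group S) (isom_filter atoms a)"
    using normal_filter_supported by (simp add: isom_filter_eq isom_group_def)
  show "p ` atoms \<subseteq> atoms" if "p \<in> S" for p
    using that by (auto elim!: atomE)
qed

end

section \<open>The parity colouring\<close>

context isom_model
begin

definition finite_atom_sets :: "'v set" where
  "finite_atom_sets = {F. F \<notin> atoms \<and> elts F \<subseteq> atoms \<and> finite (elts F)}"

text \<open>The existential avoids choosing an order on the pair, and f \<noteq> g excludes the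
  unspecified \<open>Delta f f\<close>. Even levels will receive colour 1, so odd pairs share colour
  0 with all sets that are not pairs.\<close>

definition even_pair :: "'v \<Rightarrow> bool" where
  "even_pair F \<longleftrightarrow> (\<exists>f g. f \<noteq> g \<and> elts F = {a f, a g} \<and> even (Delta f g))"

definition colour :: "'v \<Rightarrow> 'v" where
  "colour F = num (if even_pair F then 1 else 0)"

lemma small_finite_atom_sets: "small finite_atom_sets"
  by (rule small_subset[OF small_Pow[OF small_atoms]]) (auto simp: finite_atom_sets_def)

lemma finite_atom_sets_in_D: "finite_atom_sets \<subseteq> D"
  using finite_in_D atom_in_D unfolding finite_atom_sets_def by blast

lemma act_finite_atom_set:
  assumes "p \<in> S" "F \<in> finite_atom_sets"
  shows "act elts atoms p F \<in> finite_atom_sets" and "elts (act elts atoms p F) = p ` elts F"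
proof -
  have F: "F \<notin> atoms" "elts F \<subseteq> atoms" "finite (elts F)"
    using assms(2) by (auto simp: finite_atom_sets_def)
  show elts: "elts (act elts atoms p F) = p ` elts F"
    using act_set[OF F(1), of p] F(2) act_atom by (metis image_cong subset_iff)
  show "act elts atoms p F \<in> finite_atom_sets"
    using act_set[OF F(1), of p] F preserves_atoms[OF assms(1)]
    unfolding finite_atom_sets_def mem_Collect_eq elts by blast
qed

text \<open>Isometries preserve \<open>Delta\<close>. The converse implication follows later by
  applying this one to the inverse permutation.\<close>

lemma even_pair_act_if:
  assumes "p \<in> S" "F \<in> finite_atom_sets" "even_pair F"
  shows "even_pair (act elts atoms p F)"
proof -
  obtain \<phi> where \<phi>: "p = atom_perm atoms a \<phi>" "baire_isometry \<phi>" using assms(1) by blast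
  obtain f g where fg: "f \<noteq> g" "elts F = {a f, a g}" "even (Delta f g)"
    using assms(3) by (auto simp: even_pair_def)
  have ne: "\<phi> f \<noteq> \<phi> g"
    using \<phi>(2) fg(1) by (auto simp: baire_isometry_def bij_def inj_def)
  moreover have "Delta (\<phi> f) (\<phi> g) = Delta f g"
    using \<phi>(2) ne fg(1) unfolding baire_isometry_def baire_dist_def
    by (metis (no_types, lifting) add_left_cancel div_by_1 divide_divide_eq_right mult_1 of_nat_eq_iff)
  moreover have "elts (act elts atoms p F) = {a (\<phi> f), a (\<phi> g)}"
    using act_finite_atom_set(2)[OF assms(1,2)] fg(2) \<phi>(1) by simp
  ultimately show ?thesis
    unfolding even_pair_def using fg(3) by metis
qed

lemma colour_act:
  assumes "p \<in> S" "F \<in> finite_atom_sets"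
  shows "colour (act elts atoms p F) = colour F"
proof -
  obtain q where q: "q \<in> S" "\<forall>x. act elts atoms q (act elts atoms p x) = x"
    "\<forall>x. act elts atoms p (act elts atoms q x) = x"
    by (rule inverse_perm[OF assms(1)])
  have "even_pair (act elts atoms p F) \<longleftrightarrow> even_pair F"
    using even_pair_act_if[OF assms] even_pair_act_if[OF q(1) act_finite_atom_set(1)[OF assms]]
    unfolding q(2)[rule_format] by blast
  then show ?thesis by (simp add: colour_def)
qed

text \<open>A pair determines \<open>f\<close> and \<open>g\<close> up to order, and
  \<open>Delta\<close> is symmetric, so every witness in \<open>even_pair\<close> gives the same
  parity.\<close>

lemma colour_pair:
  assumes "f \<noteq> g" "elts F = {a f, a g}"
  shows "colour F = num (if even (Delta f g) then 1 else 0)"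
proof -
  have "Delta f' g' = Delta f g" if "{a f, a g} = {a f', a g'}" for f' g'
    using that Delta_commute by (auto simp: doubleton_eq_iff)
  then have "even_pair F \<longleftrightarrow> even (Delta f g)"
    unfolding even_pair_def using assms by metis
  then show ?thesis by (simp add: colour_def)
qed

text \<open>Stated without any colouring: one point \<open>f\<close> realises every sufficiently
  large level \<open>j\<close> among the sums.\<close>

lemma FS2_contains_pairs:
  assumes Y: "Y \<in> D" "elts Y \<subseteq> finite_atom_sets" "infinite (elts Y)"
  obtains f m where "\<And>j. j \<ge> m \<Longrightarrow> in_FS2 D elts atoms (upair (a f) (a (f(j := Suc (f j))))) Y"
proof -
  have "{p \<in> carrier (isom_group atoms a). act elts atoms p Y = Y} \<in> supported_subgroups"
    using D_sym[OF Y(1)] by (simp add: symmetric_def isom_filter_eq isom_group_def)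
  then obtain n E where E: "finite E"
    "\<And>p. p \<in> basic_subgroup atoms a n E \<Longrightarrow> act elts atoms p Y = Y"
    unfolding supported_subgroups_def by blast
  have "\<exists>H \<in> elts Y. \<not> elts H \<subseteq> a ` E"
  proof (rule ccontr)
    assume "\<not> (\<exists>H \<in> elts Y. \<not> elts H \<subseteq> a ` E)"
    then have "elts ` elts Y \<subseteq> Pow (a ` E)" by blast
    then have "finite (elts ` elts Y)"
      by (rule finite_subset) (simp add: E(1))
    moreover have "inj_on elts (elts Y)"
      using Y(2) extensionality unfolding finite_atom_sets_def inj_on_def by blast
    ultimately show False using Y(3) finite_imageD by blast
  qed
  then obtain H x where H: "H \<in> elts Y" "x \<in> elts H" "x \<notin> a ` E" by blast
  have Hfin: "H \<in> finite_atom_sets" using H(1) Y(2) by blast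
  then have "x \<in> atoms" using H(2) by (auto simp: finite_atom_sets_def)
  then obtain f where f: "x = a f" by (rule atomE)
  \<comment> \<open>The points to be kept fixed: those of \<open>E\<close>, so that the isometry
    stabilizes \<open>Y\<close>, and the remaining points of \<open>H\<close>, so that they cancel
    in the symmetric difference.\<close>
  define B where "B = E \<union> (a -` elts H - {f})"
  have "finite (a -` elts H)"
    using Hfin by (intro finite_vimageI) (auto simp: finite_atom_sets_def inj_def)
  then have "finite B" "f \<notin> B"
    using E(1) H(3) f by (auto simp: B_def)
  then obtain m where m: "m \<ge> n" "\<forall>h \<in> B. \<not> agree m h f"
    using eventually_disagree by blast
  have "in_FS2 D elts atoms (upair (a f) (a (f(j := Suc (f j))))) Y" if j: "j \<ge> m" for j
  proof -
    let ?g = "f(j := Suc (f j))"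
    let ?p = "atom_perm atoms a (branch_swap f j)"
    let ?H' = "act elts atoms ?p H"
    \<comment> \<open>Points of \<open>B\<close> leave \<open>f\<close> before \<open>j\<close>,
      whereas \<open>?g\<close> follows \<open>f\<close> up to \<open>j\<close>. Hence they are not
      moved, and the new atom \<open>a ?g\<close> is not already in \<open>H\<close>, where it would
      cancel.\<close>
    have B: "branch_swap f j h = h" "h \<noteq> ?g" if "h \<in> B" for h
    proof -
      have "\<not> agree j h f" using m(2) that j agree_mono by blast
      then show "branch_swap f j h = h" "h \<noteq> ?g"
        by (auto simp: branch_swap_def agree_def)
    qed
    have pS: "?p \<in> S" using branch_swap_isometry by blast
    have "?p \<in> basic_subgroup atoms a n E"
    proof (rule basic_subgroupI[OF branch_swap_isometry])
      show "branch_swap f j h = h" if "h \<in> E" for h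
        using that B(1) by (simp add: B_def)
      show "agree n (branch_swap f j h) h" for h
        using branch_swap_agree m(1) j by (rule agree_mono[OF _ order_trans])
    qed
    then have H'Y: "?H' \<in> elts Y" using act_mem[OF H(1), of ?p] E(2) by metis
    have eltsH: "elts H = insert (a f) (a ` (a -` elts H - {f}))"
      using H(2) f Hfin by (auto simp: finite_atom_sets_def elim!: atomE)
    have fixed: "?p ` a ` (a -` elts H - {f}) = a ` (a -` elts H - {f})"
      unfolding image_image by (intro image_cong) (auto simp: B B_def)
    have "?p (a f) = a ?g" by (simp add: branch_swap_def)
    with eltsH fixed have elts': "elts ?H' = insert (a ?g) (a ` (a -` elts H - {f}))"
      using act_finite_atom_set(2)[OF pS Hfin] by (metis image_insert)
    have "?g \<noteq> f" by (metis fun_upd_same n_not_Suc_n)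
    moreover have "a ?g \<notin> elts H"
      using B(2)[of ?g] \<open>?g \<noteq> f\<close> by (auto simp: B_def)
    ultimately have sd: "w \<in> elts (upair (a f) (a ?g)) \<longleftrightarrow> (w \<in> elts H) \<noteq> (w \<in> elts ?H')" for w
      using eltsH elts' upair[of "a f" "a ?g"] by auto
    \<comment> \<open>\<open>in_FS2\<close> demands distinct summands; \<open>a f\<close> lies in
      exactly one of the two sets.\<close>
    from this[of "a f"] have "H \<noteq> ?H'" using upair[of "a f" "a ?g"] by auto
    moreover have "is_symdiff D elts atoms (upair (a f) (a ?g)) H ?H'"
      unfolding is_symdiff_def using sd upair by blast
    ultimately show ?thesis
      unfolding in_FS2_def using H(1) H'Y D_trans[OF _ Y(1)] by blast
  qed
  then show thesis by (rule that)
qed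

text \<open>One colouring refutes all cases at once: its values 0 and 1 are members of every numeral
  from 2 on. The infinite set is the set of all atoms.\<close>

lemma not_HT_2:
  assumes "k \<ge> 2"
  shows "\<not> HT_2 D elts atoms k"
proof
  assume HT: "HT_2 D elts atoms k"
  define X where "X = mkset atoms"
  define P where "P = mkset finite_atom_sets"
  define graph where "graph = (\<lambda>F. opair F (colour F)) ` finite_atom_sets"
  define c where "c = mkset graph"
  have X: "X \<notin> atoms" "elts X = atoms"
    unfolding X_def using mkset[OF small_atoms] by auto
  have P: "P \<notin> atoms" "elts P = finite_atom_sets"
    unfolding P_def using mkset[OF small_finite_atom_sets] by auto
  have small_graph: "small graph"
    unfolding graph_def using small_finite_atom_sets by (rule small_image)
  then have c: "c \<notin> atoms" "elts c = (\<lambda>F. opair F (colour F)) ` elts P"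
    unfolding c_def P(2) graph_def[symmetric] using mkset by auto
  have XD: "X \<in> D"
    unfolding X_def using small_atoms
  proof (rule invariant_set_in_D)
    show "atoms \<subseteq> D" using atom_in_D by blast
    show "act elts atoms p x \<in> atoms" if "p \<in> S" "x \<in> atoms" for p x
      using preserves_atoms[OF that(1)] that(2) by (auto simp: act_atom)
  qed
  have PD: "P \<in> D"
    unfolding P_def using small_finite_atom_sets finite_atom_sets_in_D act_finite_atom_set(1)
    by (rule invariant_set_in_D)
  have cD: "c \<in> D"
    unfolding c_def using small_graph
  proof (rule invariant_set_in_D)
    show "graph \<subseteq> D"
      using finite_atom_sets_in_D unfolding graph_def colour_def by (auto intro: opair_in_D num_in_D)
    show "act elts atoms p x \<in> graph" if p: "p \<in> S" and x: "x \<in> graph" for p x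
    proof -
      obtain F where F: "F \<in> finite_atom_sets" "x = opair F (colour F)"
        using x unfolding graph_def by blast
      \<comment> \<open>Colours are numerals, hence fixed; with the invariance of
        \<open>colour\<close> the permuted pair is the graph entry at the permuted set.\<close>
      have "act elts atoms p (colour F) = colour F"
        by (simp add: colour_def act_num)
      then have "act elts atoms p x = opair (act elts atoms p F) (colour (act elts atoms p F))"
        unfolding F(2) act_opair colour_act[OF p F(1)] by simp
      then show ?thesis
        unfolding graph_def using act_finite_atom_set(1)[OF p F(1)] by (rule image_eqI)
    qed
  qed
  have "infinite (range a)"
  proof
    assume "finite (range a)"
    \<comment> \<open>Constant sequences give infinitely many atoms.\<close>
    moreover have "inj (\<lambda>k. a (\<lambda>_. k))" by (auto simp: inj_def fun_eq_iff)
    ultimately have "finite ((\<lambda>k. a (\<lambda>_. k)) -` range a)" by (rule finite_vimageI)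
    moreover have "(\<lambda>k. a (\<lambda>_. k)) -` range a = UNIV" by auto
    ultimately show False by (simp only: infinite_UNIV_nat)
  qed
  then have "is_infinite D elts atoms X"
    using X is_finite_iff[OF XD X(1)] bij_a by (simp add: is_infinite_def bij_betw_def)
  moreover have "is_finite_subsets D elts atoms P X"
    unfolding is_finite_subsets_def
  proof (intro conjI ballI)
    fix F assume F: "F \<in> D"
    have "is_subset D elts atoms F X \<longleftrightarrow> F \<notin> atoms \<and> elts F \<subseteq> atoms"
      unfolding is_subset_def X(2) using X(1) D_trans[OF _ F] by blast
    then show "F \<in> elts P \<longleftrightarrow> is_subset D elts atoms F X \<and> is_finite D elts atoms F"
      unfolding P(2) finite_atom_sets_def using is_finite_iff[OF F] by auto
  qed (rule P(1))
  moreover have "is_function D elts atoms c P (num k)"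
    using cD c PD num_in_D
  proof (rule is_function_graph)
    show "colour ` elts P \<subseteq> elts (num k)"
      using num[of k] assms by (auto simp: colour_def)
  qed
  ultimately have "\<exists>Y \<in> D. is_infinite D elts atoms Y \<and> is_subset D elts atoms Y P \<and>
      (\<exists>i \<in> D. i \<in> elts (num k) \<and> (\<forall>H \<in> D. in_FS2 D elts atoms H Y \<longrightarrow> is_value D elts atoms c H i))"
    using HT[unfolded HT_2_def, THEN bspec, OF XD, THEN bspec, OF PD, THEN bspec, OF num_in_D[of k],
        THEN bspec, OF cD] is_numeral_num by simp
  then obtain Y i where Y: "Y \<in> D" "is_infinite D elts atoms Y" "is_subset D elts atoms Y P"
    and i: "i \<in> D" "\<forall>H \<in> D. in_FS2 D elts atoms H Y \<longrightarrow> is_value D elts atoms c H i"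
    by auto
  have "infinite (elts Y)"
    using Y(2) is_finite_iff[OF Y(1)] by (auto simp: is_infinite_def)
  moreover have "elts Y \<subseteq> finite_atom_sets"
    using Y(3) D_trans[OF _ Y(1)] P(2) by (auto simp: is_subset_def)
  ultimately obtain f m where
    pairs: "\<And>j. j \<ge> m \<Longrightarrow> in_FS2 D elts atoms (upair (a f) (a (f(j := Suc (f j))))) Y"
    using FS2_contains_pairs[OF Y(1)] by blast
  \<comment> \<open>The single value \<open>i\<close> is the colour of the pair at level
    \<open>j\<close>, for every large \<open>j\<close>.\<close>
  have "i = num (if even j then 1 else 0)" if "j \<ge> m" for j
  proof -
    let ?g = "f(j := Suc (f j))"
    have "f \<noteq> ?g" by (metis fun_upd_same n_not_Suc_n)
    have D: "upair (a f) (a ?g) \<in> D" by (intro upair_in_D atom_in_D a_atom)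
    have "i = colour (upair (a f) (a ?g))"
      using i(2)[THEN bspec, OF D, THEN mp, OF pairs[OF that]] is_value_graph[OF cD D i(1) c(2)] by blast
    then show ?thesis
      using colour_pair[OF \<open>f \<noteq> ?g\<close>] upair[of "a f" "a ?g"] Delta_fun_upd[of "Suc (f j)" f j] by simp
  qed
  \<comment> \<open>Consecutive levels have opposite parity, so the numerals 0 and 1 would
    coincide.\<close>
  from this[of m] this[of "Suc m"] show False by (auto split: if_splits)
qed

end

theorem theorem5p7:
  fixes elts :: "'v \<Rightarrow> 'v set" and atoms :: "'v set" and a :: "(nat \<Rightarrow> nat) \<Rightarrow> 'v"
  assumes "zfa_universe elts atoms"
    and "bij_betw a UNIV atoms"
  shows "\<not> HT_2 (perm_model elts atoms (isom_filter atoms a) (isom_group atoms a)) elts atoms 2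
    \<and> (\<forall>k>2. \<not> HT_2 (perm_model elts atoms (isom_filter atoms a) (isom_group atoms a)) elts atoms k)"
proof -
  interpret isom_model elts atoms a
    using assms by (simp add: isom_model_def isom_model_axioms_def)
  show ?thesis
    using not_HT_2 by (simp add: isom_group_def)
qed

end
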